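(* Let $(S,* )$ be a strongly simple multisemigroup which does not contain a zero element. Then: (a) For any $a,b\in S$ we have $\mathcal{L}_a\cap\mathcal{R}_b\neq\varnothing$. (b) If $H$ is an $\mathcal{H}$-class in $S$, then either $H*H=\varnothing$ or $H$ is a hypergroup. (c) For $a,b\in S$ we have $a*b\neq\varnothing$ if and only if $\mathcal{L}_a\cap\mathcal{R}_b$ is a hypergroup. (d) Assume $S\not\cong\mathbf{0}$. Then every $\mathcal{L}$-class and every $\mathcal{R}$-class in $S$ contains at least one $\mathcal{H}$-class which is a hypergroup. (e) Let $a,b\in S$ be such that $a\,\mathcal{R}\,b$ and let $s\in S^1$ be such that $b\in a*s$. Then the multivalued map $x\mapsto x*s$ is surjective from $\mathcal{L}_a$ to $\mathcal{L}_b$ and preserves both $\mathcal{R}$- and $\mathcal{H}$-classes, that is, for any $\mathcal{H}$-class $H\subset\mathcal{L}_a$ the set $H*s$ is an $\mathcal{H}$-class in $\mathcal{L}_b$ and the two $\mathcal{H}$-classes $H$ and $H*s$ are contained in the same $\mathcal{R}$-class. (f) Assume $S\not\cong\mathbf{0}$. Let $I$ be a minimal left ideal of $S$ and $J$ a minimal right ideal of $S$. Then $I\cap J=J*I$. (g) $\mathcal{H}$ is a congruence on $S$ and the quasi-semigroup $S/\mathcal{H}$ is bisimple (i.e. contains a unique $\mathcal{D}$-class) with singleton $\mathcal{H}$-classes.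
   Context: A multisemigroup is a pair $(S,* )$ with $S$ a non-empty set and $*:S\times S\to 2^S$ a map such that $(a*b)*c=a*(b*c)$ for all $a,b,c\in S$, where for $A,B\subset S$ one puts $A*B:=\bigcup_{a\in A,b\in B}a*b$ and an element is identified with the corresponding singleton. An identity is an element $1$ with $1*a=a*1=\{a\}$ for all $a\in S$. $S^1$ denotes $S$ if $S$ has an identity, and otherwise $S\cup\{1\}$ with a new element $1$ acting as the identity; thus $S^1*a=\{a\}\cup S*a$, etc. A zero element is $z\in S$ with $a*z=z*a=\{z\}$ for all $a\in S$. A subset $I\subset S$ is a left (resp. right) ideal if $s*a\subset I$ (resp. $a*s\subset I$) for all $a\in I$, $s\in S$. A minimal left (right) ideal means a non-empty left (right) ideal containing no other non-empty left (right) ideal. Green's relations: $a\,\mathcal{L}\,b$ iff $S^1*a=S^1*b$; $a\,\mathcal{R}\,b$ iff $a*S^1=b*S^1$; $\mathcal{H}=\mathcal{L}\cap\mathcal{R}$; $\mathcal{D}$ is the smallest equivalence relation containing $\mathcal{L}$ and $\mathcal{R}$. $\mathcal{L}_a,\mathcal{R}_a$ denote the corresponding classes of $a$. $S$ is simple if $S^1*a*S^1=S$ for all $a\in S$. An element $s$ is a quark if $S^1*s$ is a minimal left ideal and $s*S^1$ is a minimal right ideal. A simple multisemigroup is strongly simple if all its elements are quarks. $\mathbf{0}$ denotes the singleton multisemigroup $(\{0\},* )$ with $0*0=\varnothing$. A hypergroup is a multisemigroup $(T,* )$ with $T*a=a*T=T$ for all $a\in T$; a subset $H\subset S$ is called a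 hypergroup if $a*b\subset H$ for all $a,b\in H$ and $H$ with the restriction of $*$ is a hypergroup. Surjectivity of the multivalued map $x\mapsto x*s$ from $\mathcal{L}_a$ to $\mathcal{L}_b$ means $\mathcal{L}_a*s=\mathcal{L}_b$. An equivalence relation $\sim$ on $S$ is a left congruence if for all $a\sim b$, $c\in S$, $u\in c*a$ and $v\in c*b$ there are $u'\in c*b$ and $v'\in c*a$ with $u\sim u'$ and $v\sim v'$; right congruences are defined similarly using $a*c$, $b*c$; a congruence is both a left and a right congruence. For a congruence $\sim$, the quotient $S/{\sim}$ is a multisemigroup with $A\circ B=\{C\in S/{\sim}\mid \exists\, a\in A,b\in B,c\in C: c\in a*b\}$. A quasi-semigroup is a multisemigroup in which every product of two elements is either empty or a single element. *)

theory Defs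
  imports Main
begin

text \<open>
  A multisemigroup is given by an explicit carrier \<open>S\<close> and a multivalued operation \<open>m\<close>, of
  which only the values on \<open>S\<close> matter. Explicit carriers are needed because quotients and subsets
  are considered as multisemigroups in their own right.
\<close>

definition set_mult :: "('a \<Rightarrow> 'a \<Rightarrow> 'a set) \<Rightarrow> 'a set \<Rightarrow> 'a set \<Rightarrow> 'a set" where
  "set_mult m A B = (\<Union>a\<in>A. \<Union>b\<in>B. m a b)"

definition multisemigroup :: "'a set \<Rightarrow> ('a \<Rightarrow> 'a \<Rightarrow> 'a set) \<Rightarrow> bool" where
  "multisemigroup S m \<longleftrightarrow>
     S \<noteq> {} \<and> (\<forall>a\<in>S. \<forall>b\<in>S. m a b \<subseteq> S) \<and>
     (\<forall>a\<in>S. \<forall>b\<in>S. \<forall>c\<in>S. set_mult m (m a b) {c} = set_mult m {a} (m b c))"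

definition multi_isomorphic ::
  "'a set \<Rightarrow> ('a \<Rightarrow> 'a \<Rightarrow> 'a set) \<Rightarrow> 'b set \<Rightarrow> ('b \<Rightarrow> 'b \<Rightarrow> 'b set) \<Rightarrow> bool" where
  "multi_isomorphic S m T n \<longleftrightarrow>
     (\<exists>f. bij_betw f S T \<and> (\<forall>a\<in>S. \<forall>b\<in>S. f ` m a b = n (f a) (f b)))"

definition zero_multisemigroup_carrier :: "nat set" where
  "zero_multisemigroup_carrier = {0}"

definition zero_multisemigroup_mult :: "nat \<Rightarrow> nat \<Rightarrow> nat set" where
  "zero_multisemigroup_mult a b = {}"

definition is_zero_multisemigroup :: "'a set \<Rightarrow> ('a \<Rightarrow> 'a \<Rightarrow> 'a set) \<Rightarrow> bool" where
  "is_zero_multisemigroup S m \<longleftrightarrow>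
     multi_isomorphic S m zero_multisemigroup_carrier zero_multisemigroup_mult"

definition is_identity :: "'a set \<Rightarrow> ('a \<Rightarrow> 'a \<Rightarrow> 'a set) \<Rightarrow> 'a \<Rightarrow> bool" where
  "is_identity S m e \<longleftrightarrow> e \<in> S \<and> (\<forall>a\<in>S. m e a = {a} \<and> m a e = {a})"

definition is_zero :: "'a set \<Rightarrow> ('a \<Rightarrow> 'a \<Rightarrow> 'a set) \<Rightarrow> 'a \<Rightarrow> bool" where
  "is_zero S m z \<longleftrightarrow> z \<in> S \<and> (\<forall>a\<in>S. m a z = {z} \<and> m z a = {z})"


text \<open>
  The multisemigroup $S^1$ lives on the option type: \<open>Some\<close> embeds \<open>S\<close>, and \<open>None\<close> is the new
  identity, which belongs to the carrier only if \<open>S\<close> has no identity of its own.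
\<close>

definition carrier1 :: "'a set \<Rightarrow> ('a \<Rightarrow> 'a \<Rightarrow> 'a set) \<Rightarrow> 'a option set" where
  "carrier1 S m = (if \<exists>e. is_identity S m e then Some ` S else insert None (Some ` S))"

fun mult1 :: "('a \<Rightarrow> 'a \<Rightarrow> 'a set) \<Rightarrow> 'a option \<Rightarrow> 'a option \<Rightarrow> 'a option set" where
  "mult1 m None y = {y}"
| "mult1 m x None = {x}"
| "mult1 m (Some a) (Some b) = Some ` m a b"

text \<open>
  The sets $S^1 * a$, $a * S^1$, $S^1 * a * S^1$ and $A * s$ (for \<open>s\<close> in $S^1$) are formed in
  $S^1$ and read as subsets of \<open>S\<close> by taking the preimage under \<open>Some\<close>.
\<close>

definition left_principal :: "'a set \<Rightarrow> ('a \<Rightarrow> 'a \<Rightarrow> 'a set) \<Rightarrow> 'a \<Rightarrow> 'a set" where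
  "left_principal S m a = Some -` set_mult (mult1 m) (carrier1 S m) {Some a}"

definition right_principal :: "'a set \<Rightarrow> ('a \<Rightarrow> 'a \<Rightarrow> 'a set) \<Rightarrow> 'a \<Rightarrow> 'a set" where
  "right_principal S m a = Some -` set_mult (mult1 m) {Some a} (carrier1 S m)"

definition two_sided_principal :: "'a set \<Rightarrow> ('a \<Rightarrow> 'a \<Rightarrow> 'a set) \<Rightarrow> 'a \<Rightarrow> 'a set" where
  "two_sided_principal S m a =
     Some -` set_mult (mult1 m) (set_mult (mult1 m) (carrier1 S m) {Some a}) (carrier1 S m)"

definition right_translate :: "('a \<Rightarrow> 'a \<Rightarrow> 'a set) \<Rightarrow> 'a set \<Rightarrow> 'a option \<Rightarrow> 'a set" where
  "right_translate m A s = Some -` set_mult (mult1 m) (Some ` A) {s}"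

lemma left_principal_eq:
  assumes "a \<in> S"
  shows "left_principal S m a = insert a (set_mult m S {a})"
  using assms unfolding left_principal_def set_mult_def carrier1_def is_identity_def
  by (auto split: if_splits) (metis imageI insertI1)

lemma right_principal_eq:
  assumes "a \<in> S"
  shows "right_principal S m a = insert a (set_mult m {a} S)"
  using assms unfolding right_principal_def set_mult_def carrier1_def is_identity_def
  by (auto split: if_splits) (metis imageI insertI1)

lemma right_translate_simps [simp]:
  "right_translate m A None = A"
  "right_translate m A (Some s) = set_mult m A {s}"
  by (auto simp: right_translate_def set_mult_def)


definition left_ideal :: "'a set \<Rightarrow> ('a \<Rightarrow> 'a \<Rightarrow> 'a set) \<Rightarrow> 'a set \<Rightarrow> bool" where
  "left_ideal S m I \<longleftrightarrow> I \<subseteq> S \<and> (\<forall>a\<in>I. \<forall>s\<in>S. m s a \<subseteq> I)"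

definition right_ideal :: "'a set \<Rightarrow> ('a \<Rightarrow> 'a \<Rightarrow> 'a set) \<Rightarrow> 'a set \<Rightarrow> bool" where
  "right_ideal S m I \<longleftrightarrow> I \<subseteq> S \<and> (\<forall>a\<in>I. \<forall>s\<in>S. m a s \<subseteq> I)"

definition minimal_left_ideal :: "'a set \<Rightarrow> ('a \<Rightarrow> 'a \<Rightarrow> 'a set) \<Rightarrow> 'a set \<Rightarrow> bool" where
  "minimal_left_ideal S m I \<longleftrightarrow>
     left_ideal S m I \<and> I \<noteq> {} \<and> (\<forall>K. left_ideal S m K \<and> K \<noteq> {} \<and> K \<subseteq> I \<longrightarrow> K = I)"

definition minimal_right_ideal :: "'a set \<Rightarrow> ('a \<Rightarrow> 'a \<Rightarrow> 'a set) \<Rightarrow> 'a set \<Rightarrow> bool" where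
  "minimal_right_ideal S m I \<longleftrightarrow>
     right_ideal S m I \<and> I \<noteq> {} \<and> (\<forall>K. right_ideal S m K \<and> K \<noteq> {} \<and> K \<subseteq> I \<longrightarrow> K = I)"


definition green_L :: "'a set \<Rightarrow> ('a \<Rightarrow> 'a \<Rightarrow> 'a set) \<Rightarrow> ('a \<times> 'a) set" where
  "green_L S m = {(a, b). a \<in> S \<and> b \<in> S \<and> left_principal S m a = left_principal S m b}"

definition green_R :: "'a set \<Rightarrow> ('a \<Rightarrow> 'a \<Rightarrow> 'a set) \<Rightarrow> ('a \<times> 'a) set" where
  "green_R S m = {(a, b). a \<in> S \<and> b \<in> S \<and> right_principal S m a = right_principal S m b}"

definition green_H :: "'a set \<Rightarrow> ('a \<Rightarrow> 'a \<Rightarrow> 'a set) \<Rightarrow> ('a \<times> 'a) set" where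
  "green_H S m = green_L S m \<inter> green_R S m"

definition green_D :: "'a set \<Rightarrow> ('a \<Rightarrow> 'a \<Rightarrow> 'a set) \<Rightarrow> ('a \<times> 'a) set" where
  "green_D S m = \<Inter>{E. equiv S E \<and> green_L S m \<subseteq> E \<and> green_R S m \<subseteq> E}"

abbreviation L_class :: "'a set \<Rightarrow> ('a \<Rightarrow> 'a \<Rightarrow> 'a set) \<Rightarrow> 'a \<Rightarrow> 'a set" where
  "L_class S m a \<equiv> green_L S m `` {a}"

abbreviation R_class :: "'a set \<Rightarrow> ('a \<Rightarrow> 'a \<Rightarrow> 'a set) \<Rightarrow> 'a \<Rightarrow> 'a set" where
  "R_class S m a \<equiv> green_R S m `` {a}"

abbreviation L_classes :: "'a set \<Rightarrow> ('a \<Rightarrow> 'a \<Rightarrow> 'a set) \<Rightarrow> 'a set set" where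
  "L_classes S m \<equiv> S // green_L S m"

abbreviation R_classes :: "'a set \<Rightarrow> ('a \<Rightarrow> 'a \<Rightarrow> 'a set) \<Rightarrow> 'a set set" where
  "R_classes S m \<equiv> S // green_R S m"

abbreviation H_classes :: "'a set \<Rightarrow> ('a \<Rightarrow> 'a \<Rightarrow> 'a set) \<Rightarrow> 'a set set" where
  "H_classes S m \<equiv> S // green_H S m"

abbreviation D_classes :: "'a set \<Rightarrow> ('a \<Rightarrow> 'a \<Rightarrow> 'a set) \<Rightarrow> 'a set set" where
  "D_classes S m \<equiv> S // green_D S m"


definition simple_multisemigroup :: "'a set \<Rightarrow> ('a \<Rightarrow> 'a \<Rightarrow> 'a set) \<Rightarrow> bool" where
  "simple_multisemigroup S m \<longleftrightarrow>
     multisemigroup S m \<and> (\<forall>a\<in>S. two_sided_principal S m a = S)"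

definition quark :: "'a set \<Rightarrow> ('a \<Rightarrow> 'a \<Rightarrow> 'a set) \<Rightarrow> 'a \<Rightarrow> bool" where
  "quark S m s \<longleftrightarrow>
     minimal_left_ideal S m (left_principal S m s) \<and>
     minimal_right_ideal S m (right_principal S m s)"

definition strongly_simple :: "'a set \<Rightarrow> ('a \<Rightarrow> 'a \<Rightarrow> 'a set) \<Rightarrow> bool" where
  "strongly_simple S m \<longleftrightarrow> simple_multisemigroup S m \<and> (\<forall>s\<in>S. quark S m s)"

definition bisimple :: "'a set \<Rightarrow> ('a \<Rightarrow> 'a \<Rightarrow> 'a set) \<Rightarrow> bool" where
  "bisimple S m \<longleftrightarrow> (\<exists>!C. C \<in> D_classes S m)"


definition hypergroup :: "'a set \<Rightarrow> ('a \<Rightarrow> 'a \<Rightarrow> 'a set) \<Rightarrow> bool" where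
  "hypergroup T m \<longleftrightarrow>
     multisemigroup T m \<and> (\<forall>a\<in>T. set_mult m T {a} = T \<and> set_mult m {a} T = T)"

definition hypergroup_subset :: "'a set \<Rightarrow> ('a \<Rightarrow> 'a \<Rightarrow> 'a set) \<Rightarrow> 'a set \<Rightarrow> bool" where
  "hypergroup_subset S m H \<longleftrightarrow>
     H \<subseteq> S \<and> (\<forall>a\<in>H. \<forall>b\<in>H. m a b \<subseteq> H) \<and> hypergroup H m"

definition quasi_semigroup :: "'a set \<Rightarrow> ('a \<Rightarrow> 'a \<Rightarrow> 'a set) \<Rightarrow> bool" where
  "quasi_semigroup S m \<longleftrightarrow>
     multisemigroup S m \<and> (\<forall>a\<in>S. \<forall>b\<in>S. m a b = {} \<or> is_singleton (m a b))"


text \<open>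
  In the two congruence conditions every element of one product has an equivalent partner in the
  other product, also when that other product might be empty. This implies the version in which
  \<open>u\<close> and \<open>v\<close> are quantified jointly (lemma \<open>left_congruence_joint\<close>); the joint version alone
  is void as soon as one of the two products is empty, and does not make the quotient operation
  associative.
\<close>

definition left_congruence :: "'a set \<Rightarrow> ('a \<Rightarrow> 'a \<Rightarrow> 'a set) \<Rightarrow> ('a \<times> 'a) set \<Rightarrow> bool" where
  "left_congruence S m E \<longleftrightarrow>
     equiv S E \<and>
     (\<forall>a b. (a, b) \<in> E \<longrightarrow> (\<forall>c\<in>S.
        (\<forall>u\<in>m c a. \<exists>u'\<in>m c b. (u, u') \<in> E) \<and>
        (\<forall>v\<in>m c b. \<exists>v'\<in>m c a. (v, v') \<in> E)))"

definition right_congruence :: "'a set \<Rightarrow> ('a \<Rightarrow> 'a \<Rightarrow> 'a set) \<Rightarrow> ('a \<times> 'a) set \<Rightarrow> bool" where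
  "right_congruence S m E \<longleftrightarrow>
     equiv S E \<and>
     (\<forall>a b. (a, b) \<in> E \<longrightarrow> (\<forall>c\<in>S.
        (\<forall>u\<in>m a c. \<exists>u'\<in>m b c. (u, u') \<in> E) \<and>
        (\<forall>v\<in>m b c. \<exists>v'\<in>m a c. (v, v') \<in> E)))"

definition congruence :: "'a set \<Rightarrow> ('a \<Rightarrow> 'a \<Rightarrow> 'a set) \<Rightarrow> ('a \<times> 'a) set \<Rightarrow> bool" where
  "congruence S m E \<longleftrightarrow> left_congruence S m E \<and> right_congruence S m E"

lemma left_congruence_joint:
  assumes "left_congruence S m E" "(a, b) \<in> E" "c \<in> S" "u \<in> m c a" "v \<in> m c b"
  shows "\<exists>u'\<in>m c b. \<exists>v'\<in>m c a. (u, u') \<in> E \<and> (v, v') \<in> E"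
  using assms unfolding left_congruence_def by meson

lemma right_congruence_joint:
  assumes "right_congruence S m E" "(a, b) \<in> E" "c \<in> S" "u \<in> m a c" "v \<in> m b c"
  shows "\<exists>u'\<in>m b c. \<exists>v'\<in>m a c. (u, u') \<in> E \<and> (v, v') \<in> E"
  using assms unfolding right_congruence_def by meson

definition quotient_mult ::
  "'a set \<Rightarrow> ('a \<Rightarrow> 'a \<Rightarrow> 'a set) \<Rightarrow> ('a \<times> 'a) set \<Rightarrow> 'a set \<Rightarrow> 'a set \<Rightarrow> 'a set set" where
  "quotient_mult S m E A B = {C \<in> S // E. \<exists>a\<in>A. \<exists>b\<in>B. \<exists>c\<in>C. c \<in> m a b}"

end

theory Submission
  imports Defs
begin

text \<open>
  Picture \<open>S\<close> as an egg-box whose columns are the \<open>\<L>\<close>-classes and whose rows are the \<open>\<R>\<close>-classes.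
  Since every element is a quark, the class \<open>\<L>\<^sub>a\<close> is the whole minimal left ideal $S^1 * a$
  (lemma \<open>L_class_eq_left_principal\<close>), and dually for \<open>\<R>\<close>. Three consequences carry everything else.

  A product never leaves the cell prescribed by its factors: \<open>a * b\<close> lies in the column of \<open>b\<close> and the
  row of \<open>a\<close> (\<open>mult_subset_L_class_Int_R_class\<close>). Simplicity makes every column meet every row
  (\<open>L_class_meets_R_class\<close>).

  Whether \<open>a * b\<close> is empty depends only on the column of \<open>a\<close> and the row of \<open>b\<close>
  (\<open>mult_nonempty_cong\<close>), hence only on the cell in which these meet.

  If \<open>a * s\<close> is not empty, then right multiplication by \<open>s\<close> maps the column of \<open>a\<close> onto the column
  of \<open>s\<close>: the image is a non-empty left ideal inside a minimal one. As rows are preserved, each cell is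
  mapped onto a cell (\<open>L_class_Int_R_class_mult\<close>).

  So a cell either has only empty products or absorbs translation by each of its elements, which is the
  hypergroup property; and the cell containing a non-empty product is determined by the cells of
  the factors, which makes \<open>\<H>\<close> a congruence with single-valued quotient. Only the singleton with the
  empty product has a column or row without a hypergroup.
\<close>

section \<open>Passing to the opposite multiplication\<close>

definition opposite :: "('a \<Rightarrow> 'a \<Rightarrow> 'a set) \<Rightarrow> 'a \<Rightarrow> 'a \<Rightarrow> 'a set" where
  "opposite m a b = m b a"

lemma opposite_opposite [simp]: "opposite (opposite m) = m"
  by (simp add: opposite_def fun_eq_iff)

lemma set_mult_iff: "x \<in> set_mult m A B \<longleftrightarrow> (\<exists>a\<in>A. \<exists>b\<in>B. x \<in> m a b)"
  by (auto simp: set_mult_def)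

lemma set_mult_opposite [simp]: "set_mult (opposite m) A B = set_mult m B A"
  unfolding set_mult_def opposite_def by blast

lemma multisemigroup_opposite: "multisemigroup S m \<Longrightarrow> multisemigroup S (opposite m)"
  unfolding multisemigroup_def by (auto simp: opposite_def)

lemma multisemigroup_closed: "multisemigroup S m \<Longrightarrow> a \<in> S \<Longrightarrow> b \<in> S \<Longrightarrow> x \<in> m a b \<Longrightarrow> x \<in> S"
  unfolding multisemigroup_def by blast

lemma multisemigroup_assoc:
  assumes "multisemigroup S m" "a \<in> S" "b \<in> S" "c \<in> S"
  shows "(\<exists>y\<in>m a b. x \<in> m y c) \<longleftrightarrow> (\<exists>z\<in>m b c. x \<in> m a z)"
proof -
  have "set_mult m (m a b) {c} = set_mult m {a} (m b c)"
    using assms unfolding multisemigroup_def by blast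
  then have "x \<in> set_mult m (m a b) {c} \<longleftrightarrow> x \<in> set_mult m {a} (m b c)" by simp
  then show ?thesis by (simp add: set_mult_iff)
qed

lemma left_principal_opposite: "a \<in> S \<Longrightarrow> left_principal S (opposite m) a = right_principal S m a"
  by (simp add: left_principal_eq right_principal_eq)

lemma right_principal_opposite: "a \<in> S \<Longrightarrow> right_principal S (opposite m) a = left_principal S m a"
  by (simp add: left_principal_eq right_principal_eq)

lemma green_L_opposite [simp]: "green_L S (opposite m) = green_R S m"
  by (auto simp: green_L_def green_R_def left_principal_opposite)

lemma green_R_opposite [simp]: "green_R S (opposite m) = green_L S m"
  by (auto simp: green_L_def green_R_def right_principal_opposite)

lemma minimal_left_ideal_opposite [simp]:
  "minimal_left_ideal S (opposite m) I \<longleftrightarrow> minimal_right_ideal S m I"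
  by (simp add: minimal_left_ideal_def minimal_right_ideal_def left_ideal_def right_ideal_def
      opposite_def)

lemma minimal_right_ideal_opposite [simp]:
  "minimal_right_ideal S (opposite m) I \<longleftrightarrow> minimal_left_ideal S m I"
  by (simp add: minimal_left_ideal_def minimal_right_ideal_def left_ideal_def right_ideal_def
      opposite_def)

lemma two_sided_principal_iff:
  "x \<in> two_sided_principal S m a \<longleftrightarrow> (\<exists>c\<in>left_principal S m a. x \<in> right_principal S m c)"
proof -
  \<comment> \<open>The new identity never occurs in $S^1 * a$, so every intermediate factor is an embedded element.\<close>
  have "\<forall>y\<in>set_mult (mult1 m) (carrier1 S m) {Some a}. \<exists>c. y = Some c"
  proof
    fix y assume "y \<in> set_mult (mult1 m) (carrier1 S m) {Some a}"
    then obtain t where "y \<in> mult1 m t (Some a)" by (auto simp: set_mult_iff)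
    then show "\<exists>c. y = Some c" by (cases t) auto
  qed
  then show ?thesis
    unfolding two_sided_principal_def left_principal_def right_principal_def
    by (force simp: set_mult_iff)
qed

lemma two_sided_principal_opposite:
  assumes "multisemigroup S m" "a \<in> S"
  shows "two_sided_principal S (opposite m) a = two_sided_principal S m a"
proof -
  have expand: "x \<in> two_sided_principal S n a \<longleftrightarrow>
      x = a \<or> (\<exists>t\<in>S. x \<in> n a t) \<or> (\<exists>s\<in>S. x \<in> n s a) \<or> (\<exists>s\<in>S. \<exists>t\<in>S. \<exists>y\<in>n s a. x \<in> n y t)"
    if "multisemigroup S n" for n x
  proof -
    have "left_principal S n a \<subseteq> S"
      using multisemigroup_closed[OF that _ assms(2)] assms(2)
      by (auto simp: left_principal_eq set_mult_iff)
    then have "x \<in> two_sided_principal S n a \<longleftrightarrow>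
        (\<exists>c\<in>left_principal S n a. x \<in> insert c (set_mult n {c} S))"
      unfolding two_sided_principal_iff using right_principal_eq[of _ S n] by blast
    then have "x \<in> two_sided_principal S n a \<longleftrightarrow>
        (\<exists>c\<in>insert a (set_mult n S {a}). x = c \<or> (\<exists>t\<in>S. x \<in> n c t))"
      using assms(2) by (simp add: left_principal_eq set_mult_iff)
    then show ?thesis unfolding set_mult_def by blast
  qed
  have "(\<exists>y\<in>m s a. x \<in> m y t) \<longleftrightarrow> (\<exists>z\<in>m a t. x \<in> m s z)" if "s \<in> S" "t \<in> S" for s t x
    using multisemigroup_assoc[OF assms(1)] assms(2) that by blast
  then have "(\<exists>s\<in>S. \<exists>t\<in>S. \<exists>y\<in>m s a. x \<in> m y t) \<longleftrightarrow> (\<exists>t\<in>S. \<exists>s\<in>S. \<exists>z\<in>m a t. x \<in> m s z)" for x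
    by blast
  then show ?thesis
    using expand[OF assms(1)] expand[OF multisemigroup_opposite[OF assms(1)]]
    by (intro set_eqI) (simp add: opposite_def disj_ac)
qed

text \<open>
  Strong simplicity is self-dual, so every statement about left ideals and \<open>\<L>\<close> below has a
  counterpart about right ideals and \<open>\<R>\<close>, obtained by replacing the operation by its opposite.
\<close>

lemma strongly_simple_opposite:
  assumes "strongly_simple S m"
  shows "strongly_simple S (opposite m)"
  using assms
  by (auto simp: strongly_simple_def simple_multisemigroup_def quark_def multisemigroup_opposite
      two_sided_principal_opposite left_principal_opposite right_principal_opposite)

section \<open>Green classes as principal ideals\<close>

lemma equiv_green_H: "equiv S (green_H S m)"
  by (rule equivI) (auto simp: green_H_def green_L_def green_R_def refl_on_def sym_def trans_def)

lemma green_H_class_eq: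
  assumes "x \<in> L_class S m a \<inter> R_class S m b"
  shows "green_H S m `` {x} = L_class S m a \<inter> R_class S m b"
  using assms by (auto simp: green_H_def green_L_def green_R_def)

lemma H_classes_iff:
  "H \<in> H_classes S m \<longleftrightarrow> (\<exists>c\<in>S. H = L_class S m c \<inter> R_class S m c)"
proof -
  have "green_H S m `` {c} = L_class S m c \<inter> R_class S m c" for c
    by (auto simp: green_H_def)
  then show ?thesis by (auto simp: quotient_def)
qed

lemma strongly_simple_multisemigroup: "strongly_simple S m \<Longrightarrow> multisemigroup S m"
  by (simp add: strongly_simple_def simple_multisemigroup_def)

lemma strongly_simple_minimal_left:
  "strongly_simple S m \<Longrightarrow> a \<in> S \<Longrightarrow> minimal_left_ideal S m (left_principal S m a)"
  by (simp add: strongly_simple_def quark_def)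

lemma minimal_left_ideal_eq_principal:
  assumes "strongly_simple S m" "minimal_left_ideal S m I" "a \<in> I"
  shows "left_principal S m a = I"
proof -
  have I: "left_ideal S m I" and min: "\<And>K. left_ideal S m K \<Longrightarrow> K \<noteq> {} \<Longrightarrow> K \<subseteq> I \<Longrightarrow> K = I"
    using assms(2) unfolding minimal_left_ideal_def by blast+
  have a: "a \<in> S" using I assms(3) unfolding left_ideal_def by blast
  have "left_principal S m a \<subseteq> I"
    using I assms(3) unfolding left_principal_eq[OF a] set_mult_def left_ideal_def by blast
  then show ?thesis
    using strongly_simple_minimal_left[OF assms(1) a] min unfolding minimal_left_ideal_def by blast
qed

text \<open>
  Minimality of $S^1 * a$ turns the preorder underlying \<open>\<L>\<close> into \<open>\<L>\<close> itself: anything reachable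
  from \<open>a\<close> generates the same left ideal.
\<close>

lemma L_class_eq_left_principal:
  assumes "strongly_simple S m" "a \<in> S"
  shows "L_class S m a = left_principal S m a"
proof -
  have min: "minimal_left_ideal S m (left_principal S m a)"
    using strongly_simple_minimal_left[OF assms] .
  then have sub: "left_principal S m a \<subseteq> S"
    unfolding minimal_left_ideal_def left_ideal_def by blast
  have "x \<in> left_principal S m x" if "x \<in> S" for x
    using that by (simp add: left_principal_eq)
  moreover have "left_principal S m x = left_principal S m a" if "x \<in> left_principal S m a" for x
    using minimal_left_ideal_eq_principal[OF assms(1) min that] .
  ultimately have "x \<in> left_principal S m a \<longleftrightarrow>
      x \<in> S \<and> left_principal S m a = left_principal S m x" for x
    using sub by blast
  then have "left_principal S m a = {x \<in> S. left_principal S m a = left_principal S m x}"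
    by (intro set_eqI) simp
  moreover have "L_class S m a = {x \<in> S. left_principal S m a = left_principal S m x}"
    unfolding green_L_def using assms(2) by blast
  ultimately show ?thesis by simp
qed

lemma minimal_left_ideal_eq_L_class:
  assumes "strongly_simple S m" "minimal_left_ideal S m I" "a \<in> I"
  shows "I = L_class S m a"
proof -
  have "a \<in> S" using assms(2,3) unfolding minimal_left_ideal_def left_ideal_def by blast
  then show ?thesis
    using minimal_left_ideal_eq_principal[OF assms] L_class_eq_left_principal[OF assms(1)] by simp
qed

lemma green_L_mult:
  assumes "strongly_simple S m" "a \<in> S" "b \<in> S" "u \<in> m a b"
  shows "(u, b) \<in> green_L S m"
proof -
  have "u \<in> L_class S m b"
    using assms by (auto simp: L_class_eq_left_principal left_principal_eq set_mult_iff)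
  then show ?thesis by (auto simp: green_L_def)
qed

lemma green_L_cases:
  assumes "strongly_simple S m" "(a, x) \<in> green_L S m"
  obtains "x = a" | t where "t \<in> S" "x \<in> m t a"
proof -
  have "a \<in> S" "x \<in> L_class S m a" using assms(2) by (auto simp: green_L_def)
  then show thesis
    using that by (auto simp: L_class_eq_left_principal[OF assms(1)] left_principal_eq set_mult_iff)
qed

lemma green_R_mult:
  assumes "strongly_simple S m" "a \<in> S" "b \<in> S" "u \<in> m a b"
  shows "(u, a) \<in> green_R S m"
  using green_L_mult[OF strongly_simple_opposite[OF assms(1)] assms(3,2)] assms(4)
  by (simp add: opposite_def)

lemma R_class_eq_right_principal:
  assumes "strongly_simple S m" "a \<in> S"
  shows "R_class S m a = right_principal S m a"
  using L_class_eq_left_principal[OF strongly_simple_opposite[OF assms(1)] assms(2)] assms(2)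
  by (simp add: left_principal_opposite)

lemma mult_subset_L_class_Int_R_class:
  assumes "strongly_simple S m" "a \<in> S" "b \<in> S"
  shows "m a b \<subseteq> L_class S m b \<inter> R_class S m a"
proof
  fix u assume "u \<in> m a b"
  then have "(u, b) \<in> green_L S m" "(u, a) \<in> green_R S m"
    using green_L_mult green_R_mult assms by fast+
  then show "u \<in> L_class S m b \<inter> R_class S m a" by (auto simp: green_L_def green_R_def)
qed

section \<open>The egg-box structure\<close>

text \<open>
  Simplicity places \<open>b\<close> in $S^1 * a * S^1$, that is, in $c * S^1$ for some \<open>c\<close> in $S^1 * a$; and
  membership in a principal one-sided ideal already means equivalence, so this intermediate
  element \<open>c\<close> lies in the required intersection.
\<close>

lemma L_class_meets_R_class:
  assumes "strongly_simple S m" "a \<in> S" "b \<in> S"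
  shows "L_class S m a \<inter> R_class S m b \<noteq> {}"
proof -
  have "b \<in> two_sided_principal S m a"
    using assms by (simp add: strongly_simple_def simple_multisemigroup_def)
  then obtain c where c: "c \<in> L_class S m a" "b \<in> right_principal S m c"
    using assms by (auto simp: two_sided_principal_iff L_class_eq_left_principal)
  then have "c \<in> S" by (auto simp: green_L_def)
  then have "b \<in> R_class S m c"
    using c(2) R_class_eq_right_principal[OF assms(1)] by simp
  then have "c \<in> R_class S m b" by (auto simp: green_R_def)
  with c(1) show ?thesis by blast
qed

lemma mult_nonempty_green_L:
  assumes ss: "strongly_simple S m" and b: "b \<in> S" and L: "(a, x) \<in> green_L S m" and ne: "m a b \<noteq> {}"
  shows "m x b \<noteq> {}"
proof -
  have mem: "a \<in> S" "x \<in> S" and "(x, a) \<in> green_L S m" using L by (auto simp: green_L_def)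
  then show ?thesis
  proof (cases rule: green_L_cases[OF ss \<open>(x, a) \<in> green_L S m\<close>])
    case 1
    then show ?thesis using ne by simp
  next
    case (2 t)
    then have "\<exists>u. \<exists>y\<in>m t x. u \<in> m y b" using ne by blast
    then show ?thesis
      using multisemigroup_assoc[OF strongly_simple_multisemigroup[OF ss] \<open>t \<in> S\<close> mem(2) b] by blast
  qed
qed

text \<open>
  If \<open>a\<close> lies in \<open>t * x\<close>, then \<open>a * b\<close> is contained in \<open>t * (x * b)\<close>, so \<open>x * b\<close> cannot be empty; the
  right factor is moved in the same way within its \<open>\<R>\<close>-class.
\<close>

lemma mult_nonempty_cong:
  assumes ss: "strongly_simple S m" and "m a b \<noteq> {}"
    and "(a, x) \<in> green_L S m" "(b, y) \<in> green_R S m"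
  shows "m x y \<noteq> {}"
proof -
  have mem: "b \<in> S" "x \<in> S" using assms(3,4) by (auto simp: green_L_def green_R_def)
  have "m x b \<noteq> {}" using mult_nonempty_green_L[OF ss mem(1) assms(3,2)] .
  then show ?thesis
    using mult_nonempty_green_L[OF strongly_simple_opposite[OF ss] mem(2), of b y] assms(4)
    by (simp add: opposite_def)
qed

text \<open>
  The multivalued form of Green's lemma. The image of an \<open>\<L>\<close>-class under right multiplication
  is a left ideal inside the \<open>\<L>\<close>-class of the multiplier, so by minimality it is all of it as soon
  as it is non-empty. As right multiplication moves an element only within its \<open>\<R>\<close>-class, the
  equality holds separately in every row.
\<close>

lemma L_class_mult:
  assumes ss: "strongly_simple S m" and a: "a \<in> S" and s: "s \<in> S" and ne: "m a s \<noteq> {}"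
  shows "set_mult m (L_class S m a) {s} = L_class S m s"
proof -
  note ms = strongly_simple_multisemigroup[OF ss]
  let ?K = "set_mult m (L_class S m a) {s}"
  have sub: "?K \<subseteq> L_class S m s"
  proof
    fix u assume "u \<in> ?K"
    then obtain x where x: "(a, x) \<in> green_L S m" "u \<in> m x s" by (auto simp: set_mult_iff)
    then have "x \<in> S" by (simp add: green_L_def)
    then show "u \<in> L_class S m s" using mult_subset_L_class_Int_R_class[OF ss _ s] x(2) by blast
  qed
  have "left_ideal S m ?K"
    unfolding left_ideal_def
  proof (intro conjI ballI subsetI)
    fix z assume "z \<in> ?K"
    then show "z \<in> S" using sub by (auto simp: green_L_def)
  next
    fix z t u assume z: "z \<in> ?K" and t: "t \<in> S" and u: "u \<in> m t z"
    obtain x where x: "(a, x) \<in> green_L S m" "z \<in> m x s" using z by (auto simp: set_mult_iff)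
    have xS: "x \<in> S" using x(1) by (simp add: green_L_def)
    obtain y where y: "y \<in> m t x" "u \<in> m y s"
      using multisemigroup_assoc[OF ms t xS s] x(2) u by blast
    have "(y, x) \<in> green_L S m" using green_L_mult[OF ss t xS y(1)] .
    then have "(a, y) \<in> green_L S m" using x(1) by (auto simp: green_L_def)
    then show "u \<in> ?K" using y(2) by (auto simp: set_mult_iff)
  qed
  moreover have "?K \<noteq> {}"
    using ne a by (auto simp: set_mult_def green_L_def)
  moreover have "minimal_left_ideal S m (L_class S m s)"
    using strongly_simple_minimal_left[OF ss s] L_class_eq_left_principal[OF ss s] by simp
  ultimately show ?thesis
    using sub unfolding minimal_left_ideal_def by blast
qed

lemma L_class_Int_R_class_mult:
  assumes ss: "strongly_simple S m" and a: "a \<in> S" and s: "s \<in> S" and ne: "m a s \<noteq> {}"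
  shows "set_mult m (L_class S m a \<inter> R_class S m c) {s} = L_class S m s \<inter> R_class S m c"
proof -
  have row: "(u, x) \<in> green_R S m" if "u \<in> m x s" "x \<in> L_class S m a" for u x
    using green_R_mult[OF ss _ s that(1)] that(2) by (auto simp: green_L_def)
  have "(c, u) \<in> green_R S m \<longleftrightarrow> (c, x) \<in> green_R S m" if "u \<in> m x s" "x \<in> L_class S m a" for u x
    using row[OF that] by (auto simp: green_R_def)
  then have "set_mult m (L_class S m a \<inter> R_class S m c) {s}
      = set_mult m (L_class S m a) {s} \<inter> R_class S m c"
    by (auto simp: set_mult_iff) blast
  then show ?thesis using L_class_mult[OF assms] by simp
qed

lemma mult_L_class_Int_R_class:
  assumes "strongly_simple S m" "s \<in> S" "b \<in> S" "m s b \<noteq> {}"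
  shows "set_mult m {s} (L_class S m c \<inter> R_class S m b) = L_class S m c \<inter> R_class S m s"
  using L_class_Int_R_class_mult[OF strongly_simple_opposite[OF assms(1)] assms(3,2), of c] assms(4)
  by (simp add: opposite_def Int_commute)

section \<open>Hypergroup classes\<close>

text \<open>
  If the class \<open>H\<close> where the column of \<open>a\<close> meets the row of \<open>b\<close> is a hypergroup, some product of
  its elements is non-empty, and this is equivalent to \<open>a * b\<close> being non-empty. Conversely, if
  \<open>a * b\<close> is non-empty, so are all products in \<open>H\<close>, and translating \<open>H\<close> by one of its elements gives
  the whole of \<open>H\<close> by Green's lemma.
\<close>

lemma mult_nonempty_iff_hypergroup:
  assumes ss: "strongly_simple S m" and a: "a \<in> S" and b: "b \<in> S"
  shows "m a b \<noteq> {} \<longleftrightarrow> hypergroup_subset S m (L_class S m a \<inter> R_class S m b)"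
    (is "_ \<longleftrightarrow> hypergroup_subset S m ?H")
proof
  have H: "x \<in> ?H \<longleftrightarrow> x \<in> S \<and> (a, x) \<in> green_L S m \<and> (b, x) \<in> green_R S m" for x
    by (auto simp: green_L_def)
  have classes: "L_class S m x = L_class S m a" "R_class S m x = R_class S m b" "x \<in> S"
    if "x \<in> ?H" for x
    using that by (auto simp: green_L_def green_R_def)
  {
    assume ne: "m a b \<noteq> {}"
    have prod: "m x y \<noteq> {}" if "x \<in> ?H" "y \<in> ?H" for x y
      using mult_nonempty_cong[OF ss ne] that by (simp add: H)
    have closed: "m x y \<subseteq> ?H" if "x \<in> ?H" "y \<in> ?H" for x y
      using mult_subset_L_class_Int_R_class[OF ss classes(3)[OF that(1)] classes(3)[OF that(2)]]
      unfolding classes(1)[OF that(2)] classes(2)[OF that(1)] .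
    have "set_mult m ?H {x} = ?H" if x: "x \<in> ?H" for x
      using L_class_Int_R_class_mult[OF ss classes(3)[OF x] classes(3)[OF x] prod[OF x x], of b]
      unfolding classes(1)[OF x] .
    moreover have "set_mult m {x} ?H = ?H" if x: "x \<in> ?H" for x
      using mult_L_class_Int_R_class[OF ss classes(3)[OF x] classes(3)[OF x] prod[OF x x], of a]
      unfolding classes(2)[OF x] .
    moreover have "multisemigroup ?H m"
      unfolding multisemigroup_def
    proof (intro conjI ballI)
      show "?H \<noteq> {}" using L_class_meets_R_class[OF ss a b] .
      show "m x y \<subseteq> ?H" if "x \<in> ?H" "y \<in> ?H" for x y using closed[OF that] .
      show "set_mult m (m x y) {z} = set_mult m {x} (m y z)"
        if "x \<in> ?H" "y \<in> ?H" "z \<in> ?H" for x y z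
        using strongly_simple_multisemigroup[OF ss] that[THEN classes(3)]
        unfolding multisemigroup_def by blast
    qed
    moreover have "?H \<subseteq> S" using classes(3) by (rule subsetI)
    ultimately show "hypergroup_subset S m ?H"
      using closed unfolding hypergroup_subset_def hypergroup_def by simp
  next
    assume hyp: "hypergroup_subset S m ?H"
    then obtain x where x: "x \<in> ?H"
      unfolding hypergroup_subset_def hypergroup_def multisemigroup_def by blast
    then have "x \<in> set_mult m ?H {x}"
      using hyp unfolding hypergroup_subset_def hypergroup_def by blast
    then obtain y where y: "y \<in> ?H" "m y x \<noteq> {}" by (auto simp: set_mult_iff)
    have "(y, a) \<in> green_L S m" "(x, b) \<in> green_R S m"
      using x y(1) by (auto simp: green_L_def green_R_def)
    then show "m a b \<noteq> {}" using mult_nonempty_cong[OF ss y(2)] by blast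
  }
qed

lemma H_class_square_empty_or_hypergroup:
  assumes ss: "strongly_simple S m" and H: "H \<in> H_classes S m"
  shows "set_mult m H H = {} \<or> hypergroup_subset S m H"
proof (cases "set_mult m H H = {}")
  case False
  obtain c where c: "c \<in> S" "H = L_class S m c \<inter> R_class S m c"
    using H by (auto simp: H_classes_iff)
  obtain x y where "x \<in> H" "y \<in> H" "m x y \<noteq> {}" using False by (auto simp: set_mult_def)
  moreover from this have "(x, c) \<in> green_L S m" "(y, c) \<in> green_R S m"
    using c by (auto simp: green_L_def green_R_def)
  ultimately have "m c c \<noteq> {}" using mult_nonempty_cong[OF ss] by blast
  then show ?thesis using mult_nonempty_iff_hypergroup[OF ss c(1) c(1)] c(2) by simp
qed simp

text \<open>
  An element that annihilates everything on its right forms an \<open>\<R>\<close>-class by itself. Annihilation is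
  constant along \<open>\<L>\<close>-classes, and a column meets every row, so all elements would be of this kind;
  all products being empty, simplicity then leaves room for one element only.
\<close>

lemma exists_mult_nonempty:
  assumes ss: "strongly_simple S m" and nz: "\<not> is_zero_multisemigroup S m" and a: "a \<in> S"
  shows "\<exists>b\<in>S. m a b \<noteq> {}"
proof (rule ccontr)
  assume "\<not> ?thesis"
  then have null: "m a b = {}" if "b \<in> S" for b using that by blast
  have null_L: "m x b = {}" if "(a, x) \<in> green_L S m" "b \<in> S" for x b
    using mult_nonempty_green_L[OF ss that(2), of x a] that(1) null[OF that(2)]
    by (auto simp: green_L_def)
  have col: "(a, y) \<in> green_L S m" if y: "y \<in> S" for y
  proof -
    obtain x where x: "(a, x) \<in> green_L S m" "(y, x) \<in> green_R S m"
      using L_class_meets_R_class[OF ss a y] by auto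
    then have "x \<in> S" "y \<in> R_class S m x" by (auto simp: green_R_def)
    then have "y = x"
      using null_L[OF x(1)]
      by (auto simp: R_class_eq_right_principal[OF ss] right_principal_eq set_mult_iff)
    then show ?thesis using x(1) by simp
  qed
  then have all_null: "m x y = {}" if "x \<in> S" "y \<in> S" for x y
    using null_L that by blast
  have "x = a" if "x \<in> S" for x
    using col[OF that] green_L_cases[OF ss, of a x] all_null a by blast
  then have "S = {a}" using a by blast
  moreover have "m a a = {}" using null a by blast
  ultimately have "is_zero_multisemigroup S m"
    unfolding is_zero_multisemigroup_def multi_isomorphic_def zero_multisemigroup_carrier_def
      zero_multisemigroup_mult_def
    by (intro exI[of _ "\<lambda>_. 0"]) (auto simp: bij_betw_def)
  with nz show False ..
qed

lemma is_zero_multisemigroup_opposite [simp]: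
  "is_zero_multisemigroup S (opposite m) \<longleftrightarrow> is_zero_multisemigroup S m"
  unfolding is_zero_multisemigroup_def multi_isomorphic_def zero_multisemigroup_mult_def
    opposite_def by (intro iff_exI conj_cong refl) blast

lemma L_class_contains_hypergroup:
  assumes ss: "strongly_simple S m" and nz: "\<not> is_zero_multisemigroup S m"
    and C: "C \<in> L_classes S m"
  shows "\<exists>H\<in>H_classes S m. H \<subseteq> C \<and> hypergroup_subset S m H"
proof -
  obtain a where a: "a \<in> S" "C = L_class S m a" using C by (auto simp: quotient_def)
  obtain b where b: "b \<in> S" "m a b \<noteq> {}" using exists_mult_nonempty[OF ss nz a(1)] by blast
  obtain c where "c \<in> L_class S m a \<inter> R_class S m b"
    using L_class_meets_R_class[OF ss a(1) b(1)] by blast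
  moreover from this have "c \<in> S" by (auto simp: green_L_def)
  ultimately have H: "L_class S m a \<inter> R_class S m b \<in> H_classes S m"
    using green_H_class_eq[of c S m a b] quotientI[of c S "green_H S m"] by simp
  show ?thesis
  proof (rule bexI[OF _ H], intro conjI)
    show "L_class S m a \<inter> R_class S m b \<subseteq> C" unfolding a(2) by (rule Int_lower1)
    show "hypergroup_subset S m (L_class S m a \<inter> R_class S m b)"
      using mult_nonempty_iff_hypergroup[OF ss a(1) b(1)] b(2) by simp
  qed
qed

lemma hypergroup_subset_opposite [simp]:
  "hypergroup_subset S (opposite m) H \<longleftrightarrow> hypergroup_subset S m H"
proof -
  have "multisemigroup H (opposite m) \<longleftrightarrow> multisemigroup H m"
    using multisemigroup_opposite[of H m] multisemigroup_opposite[of H "opposite m"] by auto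
  then show ?thesis
    unfolding hypergroup_subset_def hypergroup_def by (auto simp: opposite_def[of m])
qed

lemma green_H_opposite [simp]: "green_H S (opposite m) = green_H S m"
  by (auto simp: green_H_def)

lemma R_class_contains_hypergroup:
  assumes "strongly_simple S m" "\<not> is_zero_multisemigroup S m" "C \<in> R_classes S m"
  shows "\<exists>H\<in>H_classes S m. H \<subseteq> C \<and> hypergroup_subset S m H"
  using L_class_contains_hypergroup[OF strongly_simple_opposite[OF assms(1)], of C] assms(2,3)
  by simp

section \<open>Translations and products of minimal ideals\<close>

lemma multiplier_cases:
  assumes "strongly_simple S m" "a \<in> S" "s \<in> carrier1 S m" "Some b \<in> mult1 m (Some a) s"
  obtains "s = None" "b = a"
  | t where "s = Some t" "t \<in> S" "m a t \<noteq> {}" "L_class S m t = L_class S m b"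
proof (cases s)
  case None
  then show thesis using assms(4) that(1) by simp
next
  case (Some t)
  then have t: "t \<in> S" "b \<in> m a t" using assms(3,4) by (auto simp: carrier1_def split: if_splits)
  have "(b, t) \<in> green_L S m" using green_L_mult[OF assms(1,2) t] .
  then have "L_class S m t = L_class S m b" by (auto simp: green_L_def)
  with t Some show thesis using that(2) by blast
qed

text \<open>
  A proper multiplier lies in the column of \<open>b\<close>, so Green's lemma applies with that column
  as target; the adjoined identity moves nothing.
\<close>

lemma right_translate_L_class:
  assumes ss: "strongly_simple S m" and a: "a \<in> S" and "s \<in> carrier1 S m"
    and "Some b \<in> mult1 m (Some a) s"
  shows "right_translate m (L_class S m a) s = L_class S m b"
  using assms
proof (cases rule: multiplier_cases)
  case (2 t)
  then show ?thesis using L_class_mult[OF ss a, of t] by simp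
qed simp

lemma right_translate_L_class_Int_R_class:
  assumes ss: "strongly_simple S m" and a: "a \<in> S" and "s \<in> carrier1 S m"
    and "Some b \<in> mult1 m (Some a) s"
  shows "right_translate m (L_class S m a \<inter> R_class S m c) s = L_class S m b \<inter> R_class S m c"
  using assms
proof (cases rule: multiplier_cases)
  case (2 t)
  then show ?thesis using L_class_Int_R_class_mult[OF ss a, of t c] by simp
qed simp

lemma right_translate_H_class:
  assumes ss: "strongly_simple S m" and a: "a \<in> S" and b: "b \<in> S" and s: "s \<in> carrier1 S m"
    and as: "Some b \<in> mult1 m (Some a) s"
    and H: "H \<in> H_classes S m" "H \<subseteq> L_class S m a"
  shows "right_translate m H s \<in> H_classes S m \<and>
    right_translate m H s \<subseteq> L_class S m b \<and>
    (\<exists>R\<in>R_classes S m. H \<subseteq> R \<and> right_translate m H s \<subseteq> R)"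
proof -
  obtain c where c: "c \<in> S" "H = L_class S m c \<inter> R_class S m c"
    using H(1) by (auto simp: H_classes_iff)
  then have "c \<in> H" by (auto simp: green_L_def green_R_def)
  then have "(a, c) \<in> green_L S m" using H(2) by blast
  then have "L_class S m c = L_class S m a" by (auto simp: green_L_def)
  then have eq: "right_translate m H s = L_class S m b \<inter> R_class S m c"
    using right_translate_L_class_Int_R_class[OF ss a s as] c(2) by simp
  obtain d where "d \<in> L_class S m b \<inter> R_class S m c"
    using L_class_meets_R_class[OF ss b c(1)] by blast
  moreover from this have "d \<in> S" by (auto simp: green_L_def)
  ultimately have "right_translate m H s \<in> H_classes S m"
    unfolding eq using green_H_class_eq[of d S m b c] quotientI[of d S "green_H S m"] by simp
  moreover have "R_class S m c \<in> R_classes S m" using c(1) by (rule quotientI)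
  moreover have "H \<subseteq> R_class S m c" unfolding c(2) by simp
  moreover have "right_translate m H s \<subseteq> R_class S m c" "right_translate m H s \<subseteq> L_class S m b"
    unfolding eq by simp_all
  ultimately show ?thesis by metis
qed

text \<open>
  The left ideal is the column of any common element \<open>y\<close>. Pick a product \<open>y * b\<close> that
  is not empty: multiplying \<open>y\<close> by the class in which its column meets the row of \<open>b\<close>
  covers the class of \<open>y\<close>.
\<close>

lemma minimal_ideals_Int_eq_mult:
  assumes ss: "strongly_simple S m" and nz: "\<not> is_zero_multisemigroup S m"
    and I: "minimal_left_ideal S m I" and J: "minimal_right_ideal S m J"
  shows "I \<inter> J = set_mult m J I"
proof
  have ideals: "left_ideal S m I" "right_ideal S m J"
    using I J by (simp_all add: minimal_left_ideal_def minimal_right_ideal_def)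
  then have sub: "I \<subseteq> S" "J \<subseteq> S" by (simp_all add: left_ideal_def right_ideal_def)
  show "set_mult m J I \<subseteq> I \<inter> J"
    using ideals sub unfolding set_mult_def left_ideal_def right_ideal_def by blast
  show "I \<inter> J \<subseteq> set_mult m J I"
  proof
    fix y assume y: "y \<in> I \<inter> J"
    then have yS: "y \<in> S" using sub by blast
    obtain b where b: "b \<in> S" "m y b \<noteq> {}" using exists_mult_nonempty[OF ss nz yS] by blast
    have "y \<in> L_class S m y \<inter> R_class S m y" using yS by (auto simp: green_L_def green_R_def)
    then have "y \<in> set_mult m {y} (L_class S m y \<inter> R_class S m b)"
      using mult_L_class_Int_R_class[OF ss yS b, of y] by simp
    moreover have "L_class S m y = I" using minimal_left_ideal_eq_L_class[OF ss I] y by simp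
    ultimately show "y \<in> set_mult m J I" using y by (auto simp: set_mult_iff)
  qed
qed

section \<open>Quotients by congruences\<close>

text \<open>
  The projection carries the product of two elements exactly onto the product of their classes: the two
  congruence conditions replace arbitrary representatives by the given ones, first on the left, then on
  the right. Associativity and principal ideals are transferred along it.
\<close>

lemma quotient_mult_classes:
  assumes ms: "multisemigroup S m" and E: "congruence S m E" and a: "a \<in> S" and b: "b \<in> S"
  shows "quotient_mult S m E (E `` {a}) (E `` {b}) = (\<lambda>x. E `` {x}) ` m a b"
proof -
  have eq: "equiv S E" and L: "left_congruence S m E" and R: "right_congruence S m E"
    using E by (auto simp: congruence_def left_congruence_def)
  show ?thesis
  proof (intro set_eqI iffI)
    fix C assume "C \<in> quotient_mult S m E (E `` {a}) (E `` {b})"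
    then obtain x y c where C: "C \<in> S // E" "c \<in> C"
      and x: "(a, x) \<in> E" and y: "(b, y) \<in> E" and c: "c \<in> m x y"
      by (auto simp: quotient_mult_def)
    have "y \<in> S" using eq y by (auto simp: equiv_def)
    then obtain d where d: "(c, d) \<in> E" "d \<in> m a y"
      using R x c unfolding right_congruence_def by blast
    obtain e where e: "(d, e) \<in> E" "e \<in> m a b"
      using L y d(2) a unfolding left_congruence_def by blast
    have "C = E `` {c}"
      using C eq by (metis Image_singleton_iff equiv_class_eq_iff quotientE)
    also have "\<dots> = E `` {e}" using d(1) e(1) eq by (metis equiv_class_eq)
    finally show "C \<in> (\<lambda>x. E `` {x}) ` m a b" using e(2) by blast
  next
    fix C assume "C \<in> (\<lambda>x. E `` {x}) ` m a b"
    then obtain c where c: "c \<in> m a b" "C = E `` {c}" by blast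
    have "c \<in> S" using multisemigroup_closed[OF ms a b c(1)] .
    then have "C \<in> S // E" "c \<in> C"
      using c(2) equiv_class_self[OF eq] by (simp_all add: quotientI)
    moreover have "a \<in> E `` {a}" "b \<in> E `` {b}" using equiv_class_self[OF eq] a b by simp_all
    ultimately show "C \<in> quotient_mult S m E (E `` {a}) (E `` {b})"
      using c(1) unfolding quotient_mult_def by blast
  qed
qed

lemma set_mult_quotient:
  assumes "multisemigroup S m" "congruence S m E" "A \<subseteq> S" "B \<subseteq> S"
  shows "set_mult (quotient_mult S m E) ((\<lambda>x. E `` {x}) ` A) ((\<lambda>x. E `` {x}) ` B)
    = (\<lambda>x. E `` {x}) ` set_mult m A B"
proof -
  have "set_mult (quotient_mult S m E) ((\<lambda>x. E `` {x}) ` A) ((\<lambda>x. E `` {x}) ` B)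
      = (\<Union>a\<in>A. \<Union>b\<in>B. quotient_mult S m E (E `` {a}) (E `` {b}))"
    by (simp add: set_mult_def)
  also have "\<dots> = (\<Union>a\<in>A. \<Union>b\<in>B. (\<lambda>x. E `` {x}) ` m a b)"
    using quotient_mult_classes[OF assms(1,2)] assms(3,4) by (intro SUP_cong refl) blast
  also have "\<dots> = (\<lambda>x. E `` {x}) ` set_mult m A B" by (auto simp: set_mult_def)
  finally show ?thesis .
qed

lemma quotient_eq_image: "S // E = (\<lambda>x. E `` {x}) ` S"
  by (auto simp: quotient_def)

lemma multisemigroup_quotient:
  assumes ms: "multisemigroup S m" and E: "congruence S m E"
  shows "multisemigroup (S // E) (quotient_mult S m E)"
proof -
  let ?q = "quotient_mult S m E" and ?p = "\<lambda>x. E `` {x}"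
  have closed: "m a b \<subseteq> S" if "a \<in> S" "b \<in> S" for a b
    using multisemigroup_closed[OF ms that] by blast
  have "set_mult ?q (?q (?p a) (?p b)) {?p c} = set_mult ?q {?p a} (?q (?p b) (?p c))"
    if "a \<in> S" "b \<in> S" "c \<in> S" for a b c
  proof -
    have "set_mult m (m a b) {c} = set_mult m {a} (m b c)"
      using ms that unfolding multisemigroup_def by blast
    then show ?thesis
      using set_mult_quotient[OF ms E, of "m a b" "{c}"] set_mult_quotient[OF ms E, of "{a}" "m b c"]
        closed that by (simp add: quotient_mult_classes[OF ms E])
  qed
  moreover have "?q (?p a) (?p b) \<subseteq> ?p ` S" if "a \<in> S" "b \<in> S" for a b
    using quotient_mult_classes[OF ms E that] closed[OF that] by auto
  moreover have "?p ` S \<noteq> {}" using ms by (auto simp: multisemigroup_def)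
  ultimately show ?thesis
    unfolding multisemigroup_def quotient_eq_image by simp
qed

lemma left_principal_quotient:
  assumes "multisemigroup S m" "congruence S m E" "a \<in> S"
  shows "left_principal (S // E) (quotient_mult S m E) (E `` {a})
    = (\<lambda>x. E `` {x}) ` left_principal S m a"
  using set_mult_quotient[OF assms(1,2), of S "{a}"] assms(3)
  by (simp add: left_principal_eq quotientI) (simp add: quotient_eq_image)

lemma right_principal_quotient:
  assumes "multisemigroup S m" "congruence S m E" "a \<in> S"
  shows "right_principal (S // E) (quotient_mult S m E) (E `` {a})
    = (\<lambda>x. E `` {x}) ` right_principal S m a"
  using set_mult_quotient[OF assms(1,2), of "{a}" S] assms(3)
  by (simp add: right_principal_eq quotientI) (simp add: quotient_eq_image)

section \<open>The quotient by \<open>\<H>\<close>\<close>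

text \<open>
  The product \<open>c * a\<close> lies in the class where the column of \<open>a\<close> meets the row of \<open>c\<close>, and whether it
  is empty depends on the row of \<open>a\<close>. Replacing \<open>a\<close> by an \<open>\<H>\<close>-equivalent element changes neither.
\<close>

lemma left_congruence_green_H:
  assumes ss: "strongly_simple S m"
  shows "left_congruence S m (green_H S m)"
proof -
  have half: "\<exists>u'\<in>m c b. (u, u') \<in> green_H S m"
    if ab: "(a, b) \<in> green_H S m" and c: "c \<in> S" and u: "u \<in> m c a" for a b c u
  proof -
    have mem: "a \<in> S" "b \<in> S" and L: "(a, b) \<in> green_L S m" and R: "(a, b) \<in> green_R S m"
      using ab by (auto simp: green_H_def green_L_def)
    have "(c, c) \<in> green_L S m" using c by (simp add: green_L_def)
    then obtain u' where u': "u' \<in> m c b"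
      using mult_nonempty_cong[OF ss _ _ R, of c c] u by blast
    have "(u, a) \<in> green_L S m" "(u, c) \<in> green_R S m"
      using green_L_mult[OF ss c mem(1) u] green_R_mult[OF ss c mem(1) u] .
    moreover have "(u', b) \<in> green_L S m" "(u', c) \<in> green_R S m"
      using green_L_mult[OF ss c mem(2) u'] green_R_mult[OF ss c mem(2) u'] .
    ultimately have "(u, u') \<in> green_H S m"
      using L by (simp add: green_H_def green_L_def green_R_def)
    then show ?thesis using u' by blast
  qed
  have "(b, a) \<in> green_H S m" if "(a, b) \<in> green_H S m" for a b
    using that by (auto simp: green_H_def green_L_def green_R_def)
  with half show ?thesis
    unfolding left_congruence_def using equiv_green_H by blast
qed

lemma congruence_green_H:
  assumes "strongly_simple S m"
  shows "congruence S m (green_H S m)"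
  using left_congruence_green_H[OF assms]
    left_congruence_green_H[OF strongly_simple_opposite[OF assms]]
  by (simp add: congruence_def left_congruence_def right_congruence_def opposite_def)

lemma quasi_semigroup_quotient_green_H:
  assumes ss: "strongly_simple S m"
  shows "quasi_semigroup (S // green_H S m) (quotient_mult S m (green_H S m))"
proof -
  note ms = strongly_simple_multisemigroup[OF ss] and cong = congruence_green_H[OF ss]
  let ?p = "\<lambda>x. green_H S m `` {x}"
  have "?p ` m a b = {} \<or> is_singleton (?p ` m a b)" if ab: "a \<in> S" "b \<in> S" for a b
  proof (cases "m a b = {}")
    case False
    have "?p u = L_class S m b \<inter> R_class S m a" if "u \<in> m a b" for u
      using mult_subset_L_class_Int_R_class[OF ss ab] that by (intro green_H_class_eq) blast
    with False have "?p ` m a b = {L_class S m b \<inter> R_class S m a}" by auto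
    then show ?thesis by simp
  qed simp
  then show ?thesis
    using multisemigroup_quotient[OF ms cong]
    unfolding quasi_semigroup_def quotient_eq_image
    by (auto simp: quotient_mult_classes[OF ms cong] simp del: image_is_empty)
qed

text \<open>
  Any two columns and rows of the egg-box meet, also after projection, so \<open>\<L>\<close> composed with \<open>\<R>\<close>
  already relates any two classes.
\<close>

lemma bisimple_quotient_green_H:
  assumes ss: "strongly_simple S m"
  shows "bisimple (S // green_H S m) (quotient_mult S m (green_H S m))"
proof -
  note ms = strongly_simple_multisemigroup[OF ss] and cong = congruence_green_H[OF ss]
  let ?p = "\<lambda>x. green_H S m `` {x}" and ?Q = "S // green_H S m"
    and ?q = "quotient_mult S m (green_H S m)"
  have L: "(?p a, ?p b) \<in> green_L ?Q ?q" if "(a, b) \<in> green_L S m" for a b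
    using that by (auto simp: green_L_def quotientI left_principal_quotient[OF ms cong])
  have R: "(?p a, ?p b) \<in> green_R ?Q ?q" if "(a, b) \<in> green_R S m" for a b
    using that by (auto simp: green_R_def quotientI right_principal_quotient[OF ms cong])
  have D: "(A, B) \<in> green_D ?Q ?q" if AB: "A \<in> ?Q" "B \<in> ?Q" for A B
  proof -
    obtain a b where ab: "a \<in> S" "A = ?p a" "b \<in> S" "B = ?p b" using AB by (auto simp: quotient_def)
    obtain c where "(a, c) \<in> green_L S m" "(b, c) \<in> green_R S m"
      using L_class_meets_R_class[OF ss ab(1,3)] by auto
    then have c: "(A, ?p c) \<in> green_L ?Q ?q" "(?p c, B) \<in> green_R ?Q ?q"
      using L R ab by (auto simp: green_R_def)
    show ?thesis
      unfolding green_D_def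
    proof (rule InterI, elim CollectE conjE)
      fix E assume "equiv ?Q E" "green_L ?Q ?q \<subseteq> E" "green_R ?Q ?q \<subseteq> E"
      then show "(A, B) \<in> E" using c by (meson equivE subsetD transD)
    qed
  qed
  \<comment> \<open>The full relation is an equivalence, so \<open>\<D>\<close> cannot leave the carrier.\<close>
  have "equiv ?Q (?Q \<times> ?Q)" by (rule equivI) (auto simp: refl_on_def sym_def trans_def)
  then have "green_D ?Q ?q \<subseteq> ?Q \<times> ?Q"
    unfolding green_D_def by (intro Inter_lower) (auto simp: green_L_def green_R_def)
  with D have "green_D ?Q ?q `` {A} = ?Q" if "A \<in> ?Q" for A using that by blast
  then have "D_classes ?Q ?q = (\<lambda>A. ?Q) ` ?Q" by (simp add: quotient_eq_image[of ?Q])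
  moreover have "?Q \<noteq> {}"
    using ms by (auto simp: multisemigroup_def quotient_eq_image)
  ultimately have "D_classes ?Q ?q = {?Q}" by (simp add: image_constant_conv)
  then show ?thesis unfolding bisimple_def by simp
qed

lemma H_classes_quotient_green_H_singleton:
  assumes ss: "strongly_simple S m"
    and C: "C \<in> H_classes (S // green_H S m) (quotient_mult S m (green_H S m))"
  shows "is_singleton C"
proof -
  note ms = strongly_simple_multisemigroup[OF ss] and cong = congruence_green_H[OF ss]
  let ?p = "\<lambda>x. green_H S m `` {x}" and ?Q = "S // green_H S m"
    and ?q = "quotient_mult S m (green_H S m)"
  \<comment> \<open>Projected columns contain only the classes of their own elements, because \<open>\<H>\<close> refines
    \<open>\<L>\<close>; the same holds for rows.\<close>
  have refine: "(b, a) \<in> green_L S m \<and> (b, a) \<in> green_R S m"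
    if ab: "a \<in> S" "b \<in> S" and H: "(?p a, ?p b) \<in> green_H ?Q ?q" for a b
  proof -
    have self: "a \<in> L_class S m a" "a \<in> R_class S m a" using ab by (auto simp: green_L_def green_R_def)
    have "?p ` L_class S m a = ?p ` L_class S m b" "?p ` R_class S m a = ?p ` R_class S m b"
      using H
      unfolding green_H_def[of ?Q] green_L_def[of ?Q] green_R_def[of ?Q]
        L_class_eq_left_principal[OF ss ab(1)] L_class_eq_left_principal[OF ss ab(2)]
        R_class_eq_right_principal[OF ss ab(1)] R_class_eq_right_principal[OF ss ab(2)]
      by (simp_all add: left_principal_quotient[OF ms cong] right_principal_quotient[OF ms cong] ab)
    then have "?p a \<in> ?p ` L_class S m b" "?p a \<in> ?p ` R_class S m b"
      using imageI[OF self(1), of ?p] imageI[OF self(2), of ?p] by simp_all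
    then obtain x y where x: "(b, x) \<in> green_L S m" "?p a = ?p x"
      and y: "(b, y) \<in> green_R S m" "?p a = ?p y"
      by (elim imageE) simp
    have "(x, a) \<in> green_H S m" "(y, a) \<in> green_H S m"
      using x(2) y(2) eq_equiv_class[OF _ equiv_green_H ab(1)] by metis+
    then show ?thesis using x(1) y(1) by (auto simp: green_H_def green_L_def green_R_def)
  qed
  obtain A where A: "A \<in> ?Q" "C = green_H ?Q ?q `` {A}" using C by (auto simp: quotient_def)
  obtain a where a: "a \<in> S" "A = ?p a" using A(1) by (auto simp: quotient_def)
  have "B = A" if "B \<in> C" for B
  proof -
    have AB: "(A, B) \<in> green_H ?Q ?q" using that A(2) by simp
    then have "B \<in> ?Q" by (simp add: green_H_def[of ?Q] green_L_def[of ?Q])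
    then obtain b where b: "b \<in> S" "B = ?p b" by (rule quotientE)
    then have "(b, a) \<in> green_H S m" using refine[OF a(1) b(1)] AB a(2) by (simp add: green_H_def[of S])
    then show ?thesis using equiv_class_eq[OF equiv_green_H] a(2) b(2) by simp
  qed
  moreover have "A \<in> C"
    using A equiv_class_self[OF equiv_green_H] by metis
  ultimately have "C = {A}" by blast
  then show ?thesis by simp
qed

section \<open>The structure theorem\<close>

theorem theorem18:
  fixes S :: "'a set" and m :: "'a \<Rightarrow> 'a \<Rightarrow> 'a set"
  assumes "strongly_simple S m"
    and "\<not> (\<exists>z. is_zero S m z)"
  shows
    "(\<forall>a\<in>S. \<forall>b\<in>S. L_class S m a \<inter> R_class S m b \<noteq> {}) \<and>
     (\<forall>H\<in>H_classes S m. set_mult m H H = {} \<or> hypergroup_subset S m H) \<and>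
     (\<forall>a\<in>S. \<forall>b\<in>S.
        m a b \<noteq> {} \<longleftrightarrow> hypergroup_subset S m (L_class S m a \<inter> R_class S m b)) \<and>
     (\<not> is_zero_multisemigroup S m \<longrightarrow>
        (\<forall>C\<in>L_classes S m. \<exists>H\<in>H_classes S m. H \<subseteq> C \<and> hypergroup_subset S m H) \<and>
        (\<forall>C\<in>R_classes S m. \<exists>H\<in>H_classes S m. H \<subseteq> C \<and> hypergroup_subset S m H)) \<and>
     (\<forall>a\<in>S. \<forall>b\<in>S. \<forall>s\<in>carrier1 S m.
        (a, b) \<in> green_R S m \<and> Some b \<in> mult1 m (Some a) s \<longrightarrow>
          right_translate m (L_class S m a) s = L_class S m b \<and>
          (\<forall>H\<in>H_classes S m. H \<subseteq> L_class S m a \<longrightarrow>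
             right_translate m H s \<in> H_classes S m \<and>
             right_translate m H s \<subseteq> L_class S m b \<and>
             (\<exists>R\<in>R_classes S m. H \<subseteq> R \<and> right_translate m H s \<subseteq> R))) \<and>
     (\<not> is_zero_multisemigroup S m \<longrightarrow>
        (\<forall>I J. minimal_left_ideal S m I \<and> minimal_right_ideal S m J \<longrightarrow>
           I \<inter> J = set_mult m J I)) \<and>
     (congruence S m (green_H S m) \<and>
      quasi_semigroup (S // green_H S m) (quotient_mult S m (green_H S m)) \<and>
      bisimple (S // green_H S m) (quotient_mult S m (green_H S m)) \<and>
      (\<forall>C\<in>H_classes (S // green_H S m) (quotient_mult S m (green_H S m)). is_singleton C))"
proof (intro conjI[OF _ conjI[OF _ conjI[OF _ conjI[OF _ conjI[OF _ conjI]]]]])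
  note ss = assms(1)
  show "\<forall>a\<in>S. \<forall>b\<in>S. L_class S m a \<inter> R_class S m b \<noteq> {}"
    by (intro ballI L_class_meets_R_class[OF ss])
  show "\<forall>H\<in>H_classes S m. set_mult m H H = {} \<or> hypergroup_subset S m H"
    by (intro ballI H_class_square_empty_or_hypergroup[OF ss])
  show "\<forall>a\<in>S. \<forall>b\<in>S.
      m a b \<noteq> {} \<longleftrightarrow> hypergroup_subset S m (L_class S m a \<inter> R_class S m b)"
    by (intro ballI mult_nonempty_iff_hypergroup[OF ss])
  show "\<not> is_zero_multisemigroup S m \<longrightarrow>
      (\<forall>C\<in>L_classes S m. \<exists>H\<in>H_classes S m. H \<subseteq> C \<and> hypergroup_subset S m H) \<and>
      (\<forall>C\<in>R_classes S m. \<exists>H\<in>H_classes S m. H \<subseteq> C \<and> hypergroup_subset S m H)"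
    by (intro impI conjI ballI L_class_contains_hypergroup[OF ss] R_class_contains_hypergroup[OF ss])
  show "\<forall>a\<in>S. \<forall>b\<in>S. \<forall>s\<in>carrier1 S m.
      (a, b) \<in> green_R S m \<and> Some b \<in> mult1 m (Some a) s \<longrightarrow>
        right_translate m (L_class S m a) s = L_class S m b \<and>
        (\<forall>H\<in>H_classes S m. H \<subseteq> L_class S m a \<longrightarrow>
           right_translate m H s \<in> H_classes S m \<and>
           right_translate m H s \<subseteq> L_class S m b \<and>
           (\<exists>R\<in>R_classes S m. H \<subseteq> R \<and> right_translate m H s \<subseteq> R))"
  proof (intro ballI impI, elim conjE)
    fix a b s assume a: "a \<in> S" and b: "b \<in> S" and s: "s \<in> carrier1 S m"
      and as: "Some b \<in> mult1 m (Some a) s"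
    show "right_translate m (L_class S m a) s = L_class S m b \<and>
        (\<forall>H\<in>H_classes S m. H \<subseteq> L_class S m a \<longrightarrow>
           right_translate m H s \<in> H_classes S m \<and>
           right_translate m H s \<subseteq> L_class S m b \<and>
           (\<exists>R\<in>R_classes S m. H \<subseteq> R \<and> right_translate m H s \<subseteq> R))"
      using right_translate_L_class[OF ss a s as] right_translate_H_class[OF ss a b s as]
      by (intro conjI[of "_ = _"] ballI impI)
  qed
  show "\<not> is_zero_multisemigroup S m \<longrightarrow>
      (\<forall>I J. minimal_left_ideal S m I \<and> minimal_right_ideal S m J \<longrightarrow> I \<inter> J = set_mult m J I)"
    using minimal_ideals_Int_eq_mult[OF ss] by simp
  show "congruence S m (green_H S m) \<and>
      quasi_semigroup (S // green_H S m) (quotient_mult S m (green_H S m)) \<and>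
      bisimple (S // green_H S m) (quotient_mult S m (green_H S m)) \<and>
      (\<forall>C\<in>H_classes (S // green_H S m) (quotient_mult S m (green_H S m)). is_singleton C)"
    by (intro conjI ballI congruence_green_H[OF ss] quasi_semigroup_quotient_green_H[OF ss]
        bisimple_quotient_green_H[OF ss] H_classes_quotient_green_H_singleton[OF ss])
qed

end
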